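(* Let $(A,\cdot,\circ)$ be a transposed Novikov-Poisson algebra over $\mathbf{k}$ and let $u$ be a fixed element of $A$. Then $(A,\cdot,[\cdot,\circ]_u)$ is also a transposed Novikov-Poisson algebra, where $[\cdot,\circ]_u$ is the left Kantor product of the operations $\cdot$ and $\circ$ with respect to $u$, i.e. the binary operation $$[\cdot,\circ]_u(x,y)=u\cdot(x\circ y)-(u\cdot x)\circ y-x\circ(u\cdot y)\qquad\text{for all }x,y\in A.$$
   Context: $\mathbf{k}$ is a field of characteristic not equal to $2$; all binary operations are $\mathbf{k}$-bilinear and algebras need not be unital. A (left) Novikov algebra $(A,\circ)$ is a vector space with a binary operation satisfying $(x\circ y)\circ z=(x\circ z)\circ y$ and $(x\circ y)\circ z-x\circ(y\circ z)=(y\circ x)\circ z-y\circ(x\circ z)$ for all $x,y,z$. A transposed Novikov-Poisson algebra is a triple $(A,\cdot,\circ)$ where $(A,\cdot)$ is a commutative associative algebra, $(A,\circ)$ is a Novikov algebra, and for all $x,y,z\in A$: $(x\cdot y)\circ z=(x\cdot z)\circ y$ and $2z\cdot(x\circ y)=(z\cdot x)\circ y+x\circ(z\cdot y)$. *)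

theory Defs
  imports "HOL-Computational_Algebra.Computational_Algebra"
begin

text \<open>A vector space together with a bilinear operation; no unit, associativity or
  commutativity is assumed.\<close>

locale nonassoc_algebra = vector_space scale
  for scale :: "'k::field \<Rightarrow> 'a::ab_group_add \<Rightarrow> 'a" (infixr \<open>*s\<close> 75) +
  fixes mult :: "'a \<Rightarrow> 'a \<Rightarrow> 'a"
  assumes linear_left: "Vector_Spaces.linear scale scale (\<lambda>x. mult x y)"
    and linear_right: "Vector_Spaces.linear scale scale (\<lambda>y. mult x y)"

locale comm_assoc_algebra = nonassoc_algebra scale mult
  for scale :: "'k::field \<Rightarrow> 'a::ab_group_add \<Rightarrow> 'a" (infixr \<open>*s\<close> 75)
    and mult :: "'a \<Rightarrow> 'a \<Rightarrow> 'a" (infixl \<open>\<cdot>\<close> 70) +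
  assumes mult_assoc: "(x \<cdot> y) \<cdot> z = x \<cdot> (y \<cdot> z)"
    and mult_commute: "x \<cdot> y = y \<cdot> x"

locale novikov_algebra = nonassoc_algebra scale circ
  for scale :: "'k::field \<Rightarrow> 'a::ab_group_add \<Rightarrow> 'a" (infixr \<open>*s\<close> 75)
    and circ :: "'a \<Rightarrow> 'a \<Rightarrow> 'a" (infixl \<open>\<odot>\<close> 70) +
  assumes right_commutative: "(x \<odot> y) \<odot> z = (x \<odot> z) \<odot> y"
    and left_symmetric:
      "(x \<odot> y) \<odot> z - x \<odot> (y \<odot> z) = (y \<odot> x) \<odot> z - y \<odot> (x \<odot> z)"

locale transposed_novikov_poisson_algebra =
  comm_assoc_algebra scale mult + novikov_algebra scale circ
  for scale :: "'k::field \<Rightarrow> 'a::ab_group_add \<Rightarrow> 'a" (infixr \<open>*s\<close> 75)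
    and mult :: "'a \<Rightarrow> 'a \<Rightarrow> 'a" (infixl \<open>\<cdot>\<close> 70)
    and circ :: "'a \<Rightarrow> 'a \<Rightarrow> 'a" (infixl \<open>\<odot>\<close> 70) +
  assumes mult_circ_exchange: "(x \<cdot> y) \<odot> z = (x \<cdot> z) \<odot> y"
    and transposed_compat: "2 *s (z \<cdot> (x \<odot> y)) = (z \<cdot> x) \<odot> y + x \<odot> (z \<cdot> y)"

definition left_kantor_product ::
    "('a::ab_group_add \<Rightarrow> 'a \<Rightarrow> 'a) \<Rightarrow> ('a \<Rightarrow> 'a \<Rightarrow> 'a) \<Rightarrow> 'a \<Rightarrow> 'a \<Rightarrow> 'a \<Rightarrow> 'a" where
  "left_kantor_product f g u x y = f u (g x y) - g (f u x) y - g x (f u y)"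

end

theory Submission
  imports Defs
begin

text \<open>
  The compatibility law \<open>2 u (x \<odot> y) = (u x) \<odot> y + x \<odot> (u y)\<close> collapses the Kantor product to
  \<open>- u (x \<odot> y)\<close>. Bilinearity, the exchange law and the compatibility law for this product are
  those of \<open>\<odot>\<close>, multiplied by \<open>- u\<close>. The substance is in the two Novikov identities.

  The exchange law and commutativity make \<open>(x y) \<odot> z\<close> a totally symmetric trilinear form.
  Moving \<open>u\<close> across \<open>\<odot>\<close> by the compatibility law, one finds that \<open>(u (x \<odot> y)) \<odot> z\<close> is symmetric
  in \<open>y\<close> and \<open>z\<close>; this is right commutativity of the new product.

  For left symmetry, put \<open>Q(a,b,c;x) = (a b) \<odot> (x \<odot> c)\<close>, which by the above is symmetric in
  \<open>a, b, c\<close>. The part of the new associator that is not visibly symmetric in \<open>x, y\<close> reduces to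
  \<open>2 u u ((x \<odot> y) \<odot> z) = 3 u Q(u,y,z;x) - u (((u x) \<odot> y) \<odot> z)\<close>, whose last term is symmetric.
  Away from characteristic 2 multiplication can be absorbed, \<open>u ((a b) \<odot> c) = (u a b) \<odot> c\<close>, so
  that \<open>u Q(u,y,z;x) = Q(u u,y,z;x)\<close>. Finally, a product in an argument of \<open>Q\<close> makes \<open>Q\<close>
  symmetric in \<open>x\<close> as well, since \<open>Q(u v,y,z;x) = (u y) \<odot> ((v x) \<odot> z)\<close>: the left-hand side
  is symmetric in \<open>u, v, y, z\<close> and the right-hand side in \<open>v, x, z\<close>.
\<close>

context nonassoc_algebra
begin

lemma nonassoc_mult_distribs:
  "mult (x + y) z = mult x z + mult y z"
  "mult x (y + z) = mult x y + mult x z"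
  "mult (x - y) z = mult x z - mult y z"
  "mult x (y - z) = mult x y - mult x z"
  "mult (- x) z = - mult x z"
  "mult x (- z) = - mult x z"
  "mult (c *s x) z = c *s mult x z"
  "mult x (c *s z) = c *s mult x z"
proof -
  interpret L: Vector_Spaces.linear scale scale "\<lambda>x. mult x z" for z by (rule linear_left)
  interpret R: Vector_Spaces.linear scale scale "\<lambda>z. mult x z" for x by (rule linear_right)
  show "mult (x + y) z = mult x z + mult y z" by (rule L.add)
  show "mult x (y + z) = mult x y + mult x z" by (rule R.add)
  show "mult (x - y) z = mult x z - mult y z" by (rule L.diff)
  show "mult x (y - z) = mult x y - mult x z" by (rule R.diff)
  show "mult (- x) z = - mult x z" by (rule L.neg)
  show "mult x (- z) = - mult x z" by (rule R.neg)
  show "mult (c *s x) z = c *s mult x z" by (rule L.scale)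
  show "mult x (c *s z) = c *s mult x z" by (rule R.scale)
qed

end

context vector_space
begin

lemma scale_two: "scale 2 v = v + v"
  using scale_left_distrib[of 1 1 v] by simp

lemma double_cancel:
  fixes v w :: 'b
  assumes "CHAR('a) \<noteq> 2" and "v + v = w + w"
  shows "v = w"
proof -
  have "\<not> CHAR('a) dvd 2"
    using assms(1) CHAR_not_1[where 'a = 'a] two_is_prime_nat
    unfolding prime_nat_iff by auto
  then have "(2::'a) \<noteq> 0"
    using of_nat_eq_0_iff_char_dvd[of 2, where 'a = 'a] by simp
  moreover have "scale 2 v = scale 2 w"
    using assms(2) by (simp add: scale_two)
  ultimately show ?thesis by simp
qed

end

context transposed_novikov_poisson_algebra
begin

lemma mult_algebra: "nonassoc_algebra scale (\<cdot>)"
  and circ_algebra: "nonassoc_algebra scale (\<odot>)"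
  by unfold_locales

lemmas mult_distribs = nonassoc_algebra.nonassoc_mult_distribs[OF mult_algebra]
lemmas circ_distribs = nonassoc_algebra.nonassoc_mult_distribs[OF circ_algebra]

lemma compat_sum: "z \<cdot> (x \<odot> y) + z \<cdot> (x \<odot> y) = (z \<cdot> x) \<odot> y + x \<odot> (z \<cdot> y)"
  using transposed_compat[of z x y] by (simp add: scale_two)

lemma left_kantor_product_eq: "left_kantor_product (\<cdot>) (\<odot>) u x y = - (u \<cdot> (x \<odot> y))"
  unfolding left_kantor_product_def using compat_sum[of u x y]
  by (simp add: algebra_simps)

text \<open>Form of the compatibility law that pulls a factor out of the right argument of \<open>\<odot>\<close>.\<close>

lemma circ_mult_right: "x \<odot> (z \<cdot> y) = z \<cdot> (x \<odot> y) + z \<cdot> (x \<odot> y) - (z \<cdot> x) \<odot> y"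
  using compat_sum[of z x y] by (simp add: algebra_simps)

text \<open>The form \<open>(u (x \<odot> y)) \<odot> z\<close> splits into a part symmetric in \<open>y, z\<close> and minus twice its own
  transpose; the coefficients 1 and 2 differ by a unit, so the symmetry needs no division.\<close>

lemma mult_circ_right_commutative: "(u \<cdot> (x \<odot> y)) \<odot> z = (u \<cdot> (x \<odot> z)) \<odot> y"
proof -
  have split: "(u \<cdot> (x \<odot> b)) \<odot> c + (u \<cdot> (x \<odot> c)) \<odot> b + (u \<cdot> (x \<odot> c)) \<odot> b
      = u \<cdot> ((x \<odot> b) \<odot> c) + u \<cdot> ((x \<odot> b) \<odot> c) + ((u \<cdot> x) \<odot> c) \<odot> b" for b c
  proof -
    have "(u \<cdot> (x \<odot> b)) \<odot> c + (x \<odot> (u \<cdot> c)) \<odot> b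
        = u \<cdot> ((x \<odot> b) \<odot> c) + u \<cdot> ((x \<odot> b) \<odot> c)"
      using compat_sum[of u "x \<odot> b" c] right_commutative[of x b "u \<cdot> c"] by simp
    then show ?thesis
      by (simp add: circ_mult_right circ_distribs algebra_simps)
  qed
  have "(u \<cdot> (x \<odot> y)) \<odot> z + (u \<cdot> (x \<odot> z)) \<odot> y + (u \<cdot> (x \<odot> z)) \<odot> y
      = (u \<cdot> (x \<odot> z)) \<odot> y + (u \<cdot> (x \<odot> y)) \<odot> z + (u \<cdot> (x \<odot> y)) \<odot> z"
    unfolding split right_commutative[of x y z] right_commutative[of "u \<cdot> x" y z] ..
  then show ?thesis
    by (simp add: add.commute)
qed

lemma circ_circ_swap_inner: "(a \<cdot> b) \<odot> (x \<odot> c) = (a \<cdot> c) \<odot> (x \<odot> b)"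
proof -
  have "(a \<cdot> b) \<odot> (x \<odot> c) = (a \<cdot> (x \<odot> c)) \<odot> b" by (rule mult_circ_exchange)
  also have "\<dots> = (a \<cdot> (x \<odot> b)) \<odot> c" by (rule mult_circ_right_commutative)
  also have "\<dots> = (a \<cdot> c) \<odot> (x \<odot> b)" by (rule mult_circ_exchange)
  finally show ?thesis .
qed

text \<open>Both summands of the compatibility law agree here, by total symmetry of \<open>(a b) \<odot> c\<close>.\<close>

lemma mult_circ_absorb:
  assumes "CHAR('k) \<noteq> 2"
  shows "u \<cdot> ((a \<cdot> b) \<odot> c) = (u \<cdot> (a \<cdot> b)) \<odot> c"
proof (rule double_cancel[OF assms])
  have "(a \<cdot> b) \<odot> (u \<cdot> c) = (a \<cdot> (u \<cdot> c)) \<odot> b" by (rule mult_circ_exchange)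
  also have "\<dots> = ((u \<cdot> a) \<cdot> c) \<odot> b" by (metis mult_assoc mult_commute)
  also have "\<dots> = (u \<cdot> (a \<cdot> b)) \<odot> c" by (metis mult_assoc mult_circ_exchange)
  finally show "u \<cdot> ((a \<cdot> b) \<odot> c) + u \<cdot> ((a \<cdot> b) \<odot> c)
      = (u \<cdot> (a \<cdot> b)) \<odot> c + (u \<cdot> (a \<cdot> b)) \<odot> c"
    using compat_sum[of u "a \<cdot> b" c] by simp
qed

text \<open>Twice the left-hand side is \<open>2 (u y) \<odot> (v (x \<odot> z))\<close>; the compatibility law splits it into
  the right-hand side and \<open>(u y) \<odot> (x \<odot> (v z))\<close>, which is the left-hand side again.\<close>

lemma product_circ_circ: "((u \<cdot> v) \<cdot> y) \<odot> (x \<odot> z) = (u \<cdot> y) \<odot> ((v \<cdot> x) \<odot> z)"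
proof -
  have pull: "((u \<cdot> v) \<cdot> y) \<odot> (x \<odot> z) = (u \<cdot> y) \<odot> (v \<cdot> (x \<odot> z))"
    using mult_circ_exchange[of "u \<cdot> v" y "x \<odot> z"]
      mult_circ_exchange[of u y "v \<cdot> (x \<odot> z)"] by (simp add: mult_assoc)
  have "(u \<cdot> y) \<odot> (x \<odot> (v \<cdot> z)) = (u \<cdot> (v \<cdot> z)) \<odot> (x \<odot> y)"
    by (rule circ_circ_swap_inner)
  also have "\<dots> = ((u \<cdot> v) \<cdot> y) \<odot> (x \<odot> z)"
    using circ_circ_swap_inner[of "u \<cdot> v" z x y] by (simp add: mult_assoc)
  finally have again: "(u \<cdot> y) \<odot> (x \<odot> (v \<cdot> z)) = ((u \<cdot> v) \<cdot> y) \<odot> (x \<odot> z)" .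
  have "(u \<cdot> y) \<odot> (v \<cdot> (x \<odot> z)) + (u \<cdot> y) \<odot> (v \<cdot> (x \<odot> z))
      = (u \<cdot> y) \<odot> ((v \<cdot> x) \<odot> z) + (u \<cdot> y) \<odot> (x \<odot> (v \<cdot> z))"
    using arg_cong[OF compat_sum[of v x z], of "\<lambda>w. (u \<cdot> y) \<odot> w"]
    by (simp add: circ_distribs)
  then show ?thesis
    by (simp add: pull[symmetric] again)
qed

text \<open>The transposition of \<open>x\<close> and \<open>y\<close> is obtained by conjugation: moving \<open>y\<close> to the inner
  right position, where the previous lemma exposes its symmetry with \<open>x\<close>.\<close>

lemma product_circ_circ_commute: "((u \<cdot> v) \<cdot> y) \<odot> (x \<odot> z) = ((u \<cdot> v) \<cdot> x) \<odot> (y \<odot> z)"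
proof -
  have "((u \<cdot> v) \<cdot> y) \<odot> (x \<odot> z) = ((u \<cdot> v) \<cdot> z) \<odot> (x \<odot> y)"
    by (rule circ_circ_swap_inner)
  also have "\<dots> = (u \<cdot> z) \<odot> ((v \<cdot> x) \<odot> y)"
    by (rule product_circ_circ)
  also have "\<dots> = (u \<cdot> z) \<odot> ((v \<cdot> y) \<odot> x)"
    by (simp only: mult_circ_exchange)
  also have "\<dots> = ((u \<cdot> v) \<cdot> z) \<odot> (y \<odot> x)"
    by (rule product_circ_circ[symmetric])
  also have "\<dots> = ((u \<cdot> v) \<cdot> x) \<odot> (y \<odot> z)"
    by (rule circ_circ_swap_inner)
  finally show ?thesis .
qed

lemma mult_mult_circ_circ_commute:
  assumes "CHAR('k) \<noteq> 2"
  shows "u \<cdot> (u \<cdot> ((x \<odot> y) \<odot> z)) = u \<cdot> (u \<cdot> ((y \<odot> x) \<odot> z))"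
proof -
  let ?Q = "\<lambda>a b. (u \<cdot> b) \<odot> (a \<odot> z)"
  have expand: "u \<cdot> ((a \<odot> b) \<odot> z) + u \<cdot> ((a \<odot> b) \<odot> z)
      = ?Q a b + ?Q a b + ?Q a b - ((u \<cdot> a) \<odot> b) \<odot> z" for a b
  proof -
    have Q1: "(u \<cdot> (a \<odot> b)) \<odot> z = ?Q a b" and Q2: "(u \<cdot> (a \<odot> z)) \<odot> b = ?Q a b"
      using mult_circ_right_commutative[of u a b z] mult_circ_exchange[of u b "a \<odot> z"] by simp_all
    have "(a \<odot> b) \<odot> (u \<cdot> z) = (a \<odot> (u \<cdot> z)) \<odot> b" by (rule right_commutative)
    also have "\<dots> = ?Q a b + ?Q a b - ((u \<cdot> a) \<odot> b) \<odot> z"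
      by (simp add: circ_mult_right[of a u z] circ_distribs Q2 right_commutative[of "u \<cdot> a" z b])
    finally show ?thesis
      using compat_sum[of u "a \<odot> b" z] by (simp add: Q1 algebra_simps)
  qed
  have Q_sym: "u \<cdot> ?Q x y = u \<cdot> ?Q y x"
    using product_circ_circ_commute[of u u y x z]
    by (simp add: mult_circ_absorb[OF assms] mult_assoc)
  have rest_sym: "((u \<cdot> x) \<odot> y) \<odot> z = ((u \<cdot> y) \<odot> x) \<odot> z"
    by (simp only: mult_circ_exchange)
  show ?thesis
  proof (rule double_cancel[OF assms])
    have "u \<cdot> (u \<cdot> ((a \<odot> b) \<odot> z)) + u \<cdot> (u \<cdot> ((a \<odot> b) \<odot> z))
        = u \<cdot> ?Q a b + u \<cdot> ?Q a b + u \<cdot> ?Q a b - u \<cdot> (((u \<cdot> a) \<odot> b) \<odot> z)" for a b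
      using arg_cong[OF expand[of a b], of "\<lambda>w. u \<cdot> w"] by (simp add: mult_distribs)
    then show "u \<cdot> (u \<cdot> ((x \<odot> y) \<odot> z)) + u \<cdot> (u \<cdot> ((x \<odot> y) \<odot> z))
        = u \<cdot> (u \<cdot> ((y \<odot> x) \<odot> z)) + u \<cdot> (u \<cdot> ((y \<odot> x) \<odot> z))"
      by (simp add: Q_sym rest_sym)
  qed
qed

text \<open>Pulling \<open>u\<close> out of \<open>x \<odot> (u (y \<odot> z))\<close> turns the associator of the new product into a sum
  visibly symmetric in \<open>x, y\<close> and \<open>- 2 u u (x \<odot> (y \<odot> z))\<close>. Left symmetry of \<open>\<odot>\<close> trades the
  asymmetry of the latter for that of \<open>u u ((x \<odot> y) \<odot> z)\<close>, which is zero.\<close>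

lemma mult_circ_left_symmetric:
  assumes "CHAR('k) \<noteq> 2"
  shows "u \<cdot> ((u \<cdot> (x \<odot> y)) \<odot> z) - u \<cdot> (x \<odot> (u \<cdot> (y \<odot> z)))
    = u \<cdot> ((u \<cdot> (y \<odot> x)) \<odot> z) - u \<cdot> (y \<odot> (u \<cdot> (x \<odot> z)))"
proof -
  have pull: "a \<odot> (u \<cdot> (b \<odot> z))
      = u \<cdot> (a \<odot> (b \<odot> z)) + u \<cdot> (a \<odot> (b \<odot> z)) - (u \<cdot> (b \<odot> a)) \<odot> z" for a b
    using circ_mult_right[of a u "b \<odot> z"] mult_circ_exchange[of u a "b \<odot> z"]
      mult_circ_right_commutative[of u b z a] by simp
  have "u \<cdot> (u \<cdot> ((x \<odot> y) \<odot> z)) - u \<cdot> (u \<cdot> (x \<odot> (y \<odot> z)))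
      = u \<cdot> (u \<cdot> ((y \<odot> x) \<odot> z)) - u \<cdot> (u \<cdot> (y \<odot> (x \<odot> z)))"
    using arg_cong[OF left_symmetric[of x y z], of "\<lambda>w. u \<cdot> (u \<cdot> w)"]
    by (simp add: mult_distribs)
  then have "u \<cdot> (u \<cdot> (x \<odot> (y \<odot> z))) = u \<cdot> (u \<cdot> (y \<odot> (x \<odot> z)))"
    by (simp add: mult_mult_circ_circ_commute[OF assms, of u x y z])
  then show ?thesis
    by (simp add: pull mult_distribs)
qed

end

theorem theorem2p28:
  fixes scale :: "'k::field \<Rightarrow> 'a::ab_group_add \<Rightarrow> 'a"
    and mult circ :: "'a \<Rightarrow> 'a \<Rightarrow> 'a"
    and u :: 'a
  assumes "CHAR('k) \<noteq> 2"
    and "transposed_novikov_poisson_algebra scale mult circ"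
  shows "transposed_novikov_poisson_algebra scale mult (left_kantor_product mult circ u)"
proof -
  interpret transposed_novikov_poisson_algebra scale mult circ by (rule assms(2))
  let ?k = "left_kantor_product mult circ u"
  note k_eq = left_kantor_product_eq[of u]
  note distribs = mult_distribs circ_distribs
  show ?thesis
  proof unfold_locales
    fix x y z :: 'a and c :: 'k
    show "?k (x + y) z = ?k x z + ?k y z" by (simp add: k_eq distribs)
    show "?k (scale c x) z = scale c (?k x z)" by (simp add: k_eq distribs)
    show "?k x (y + z) = ?k x y + ?k x z" by (simp add: k_eq distribs)
    show "?k x (scale c z) = scale c (?k x z)" by (simp add: k_eq distribs)
    show "?k (?k x y) z = ?k (?k x z) y"
      by (simp add: k_eq distribs mult_circ_right_commutative[of u x y z])
    show "?k (?k x y) z - ?k x (?k y z) = ?k (?k y x) z - ?k y (?k x z)"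
      using mult_circ_left_symmetric[OF assms(1), of u x y z] by (simp add: k_eq distribs)
    show "?k (mult x y) z = ?k (mult x z) y"
      by (simp add: k_eq mult_circ_exchange[of x y z])
    have "scale 2 (mult z (mult u (circ x y))) = mult u (scale 2 (mult z (circ x y)))"
      by (metis mult_distribs(8) mult_assoc mult_commute)
    then show "scale 2 (mult z (?k x y)) = ?k (mult z x) y + ?k x (mult z y)"
      by (simp add: k_eq distribs transposed_compat)
  qed
qed

end
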